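(* Let $U$ be a finite nonempty set and let $G$ be the bipartite graph with vertex set $\{u_0,u_1\}\cup U\cup\{v_0,v_1,v_2\}$, bipartition $V_1=\{u_0,u_1\}\cup U$, $V_2=\{v_0,v_1,v_2\}$, and edges determined by $N(u_0)=N(u_1)=\{v_0,v_1,v_2\}$ and $N(w)=\{v_0,v_2\}$ for every $w\in U$. Then $W_{BM}(u_0,v_0)=1$. On the other hand, the map $x:G\to\mathbb{R}$ given by $$x(a)=\begin{cases}1, & a=v_1,\\ 0, & a\in\{u_0,u_1\},\\ -1, & a\in\{v_0,v_2\},\\ -2, & a\in U\end{cases}$$ is Lipschitz and has transport profit $$W_{u_0v_0}(x)=\frac{5|U|-2}{3|U|+6},$$ and $W_{u_0v_0}(x)>W_{BM}(u_0,v_0)$ whenever $|U|>4$.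
   Context: Graphs are simple, locally finite and unweighted; $\rho$ is the geodesic graph distance. $N(w)$ is the set of neighbours of a vertex $w$, $d_w=|N(w)|$, $m_w=1/d_w$. A map $x:G\to\mathbb{R}$ on the vertices is Lipschitz if $|x(a)-x(b)|\le\rho(a,b)$ for all vertices $a,b$. For an edge $uv$ the transport profit of $x$ is $W_{uv}(x)=m_u\sum_{a\in N(u)}x(a)-m_v\sum_{b\in N(v)}x(b)$. Write $\alpha\lor\beta=\max(\alpha,\beta)$ and $[\alpha]_+=\max(\alpha,0)$. For an edge $uv$ and $(a,b)\in\{(u,v),(v,u)\}$: $\triangle(uv)=N(u)\cap N(v)$; $\square(a)\subseteq N(a)\setminus\{b\}$ is the set of neighbours of $a$ (other than $b$) lying on a 4-cycle containing the edge $uv$ but on no 3-cycle containing $uv$; $\mathrm{Pent}(a)\subseteq N(a)\setminus\{b\}$ is the set of those lying on a 5-cycle containing the edge $uv$ but on no 3- or 4-cycle containing $uv$; $\mathrm{Pent}(u,v)$ is the set of vertices at distance exactly 2 from both $u$ and $v$. Let $R=\triangle(uv)\cup\square(u)\cup\square(v)\cup\mathrm{Pent}(u)\cup\mathrm{Pent}(v)\cup\mathrm{Pent}(u,v)$, and let $R_1,\dots,R_K$ be the connected components of the subgraph of $G$ induced by $R$. Put $\square_a=|\square(a)|$ and $\square_a^k=|R_k\cap\square(a)|$. For an edge $uv$ of a bipartite graph define $$W_{BM}(u,v)=1+2\Big[1-m_u-m_v-m_u\square_u-m_v\square_v+\sum_{k=1}^K (m_u\square_u^k)\lor(m_v\square_v^k)\Big]_+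 .$$ *)

theory Defs
  imports Complex_Main "HOL-Library.Extended_Real"
begin

text \<open>A graph is given by its vertex set \<open>V\<close> and its adjacency relation \<open>E\<close>, each edge
  being represented by both of its orientations.\<close>

definition lf_simple_graph :: "'a set \<Rightarrow> 'a rel \<Rightarrow> bool" where
  "lf_simple_graph V E \<longleftrightarrow>
     E \<subseteq> V \<times> V \<and> sym E \<and> irrefl E \<and> (\<forall>w\<in>V. finite (E `` {w}))"

definition bipartition :: "'a set \<Rightarrow> 'a rel \<Rightarrow> 'a set \<Rightarrow> 'a set \<Rightarrow> bool" where
  "bipartition V E V1 V2 \<longleftrightarrow>
     V = V1 \<union> V2 \<and> V1 \<inter> V2 = {} \<and> E \<subseteq> (V1 \<times> V2) \<union> (V2 \<times> V1)"

definition nbrs :: "'a rel \<Rightarrow> 'a \<Rightarrow> 'a set" where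
  "nbrs E w = E `` {w}"

definition deg :: "'a rel \<Rightarrow> 'a \<Rightarrow> nat" where
  "deg E w = card (nbrs E w)"

definition mass :: "'a rel \<Rightarrow> 'a \<Rightarrow> real" where
  "mass E w = 1 / real (deg E w)"

text \<open>The infimum is \<open>\<infinity>\<close> for vertices in different components.\<close>

definition gdist :: "'a rel \<Rightarrow> 'a \<Rightarrow> 'a \<Rightarrow> enat" where
  "gdist E a b = (INF n\<in>{n. (a, b) \<in> E ^^ n}. enat n)"

definition graph_lipschitz :: "'a set \<Rightarrow> 'a rel \<Rightarrow> ('a \<Rightarrow> real) \<Rightarrow> bool" where
  "graph_lipschitz V E x \<longleftrightarrow>
     (\<forall>a\<in>V. \<forall>b\<in>V. ereal \<bar>x a - x b\<bar> \<le> ereal_of_enat (gdist E a b))"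

definition transport_profit :: "'a rel \<Rightarrow> ('a \<Rightarrow> real) \<Rightarrow> 'a \<Rightarrow> 'a \<Rightarrow> real" where
  "transport_profit E x u v =
     mass E u * (\<Sum>a\<in>nbrs E u. x a) - mass E v * (\<Sum>b\<in>nbrs E v. x b)"

definition is_cycle :: "'a rel \<Rightarrow> nat \<Rightarrow> 'a list \<Rightarrow> bool" where
  "is_cycle E n p \<longleftrightarrow>
     n \<ge> 3 \<and> length p = n \<and> distinct p \<and> (\<forall>i<n. (p ! i, p ! (Suc i mod n)) \<in> E)"

text \<open>\<open>w\<close> lies on an \<open>n\<close>-cycle that contains the edge \<open>uv\<close>, traversed in either direction.\<close>

definition on_cycle :: "'a rel \<Rightarrow> nat \<Rightarrow> 'a \<Rightarrow> 'a \<Rightarrow> 'a \<Rightarrow> bool" where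
  "on_cycle E n u v w \<longleftrightarrow>
     (\<exists>p. is_cycle E n p \<and> (\<exists>i<n. {p ! i, p ! (Suc i mod n)} = {u, v}) \<and> w \<in> set p)"

definition triangles :: "'a rel \<Rightarrow> 'a \<Rightarrow> 'a \<Rightarrow> 'a set" where
  "triangles E u v = nbrs E u \<inter> nbrs E v"

text \<open>\<open>squares E a b\<close> and \<open>pents E a b\<close> are the sets \<open>\<square>(a)\<close> and \<open>Pent(a)\<close> for the edge \<open>ab\<close>.\<close>

definition squares :: "'a rel \<Rightarrow> 'a \<Rightarrow> 'a \<Rightarrow> 'a set" where
  "squares E a b = {w \<in> nbrs E a - {b}. on_cycle E 4 a b w \<and> \<not> on_cycle E 3 a b w}"

definition pents :: "'a rel \<Rightarrow> 'a \<Rightarrow> 'a \<Rightarrow> 'a set" where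
  "pents E a b = {w \<in> nbrs E a - {b}.
     on_cycle E 5 a b w \<and> \<not> on_cycle E 3 a b w \<and> \<not> on_cycle E 4 a b w}"

definition pents_opp :: "'a rel \<Rightarrow> 'a \<Rightarrow> 'a \<Rightarrow> 'a set" where
  "pents_opp E u v = {w. gdist E u w = 2 \<and> gdist E v w = 2}"

definition core_nbhd :: "'a rel \<Rightarrow> 'a \<Rightarrow> 'a \<Rightarrow> 'a set" where
  "core_nbhd E u v =
     triangles E u v \<union> squares E u v \<union> squares E v u
       \<union> pents E u v \<union> pents E v u \<union> pents_opp E u v"

text \<open>Vertex sets of the connected components of the subgraph induced by \<open>R\<close>.\<close>

definition components_on :: "'a rel \<Rightarrow> 'a set \<Rightarrow> 'a set set" where
  "components_on E R = R // ((E \<inter> R \<times> R)\<^sup>* \<inter> R \<times> R)"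

definition W_BM :: "'a rel \<Rightarrow> 'a \<Rightarrow> 'a \<Rightarrow> real" where
  "W_BM E u v = 1 + 2 * max 0
     (1 - mass E u - mass E v
        - mass E u * real (card (squares E u v)) - mass E v * real (card (squares E v u))
        + (\<Sum>C\<in>components_on E (core_nbhd E u v).
             max (mass E u * real (card (C \<inter> squares E u v)))
                 (mass E v * real (card (C \<inter> squares E v u)))))"

end

theory Submission
  imports Defs
begin

text \<open>In a bipartite graph the triangles, the pentagons and \<open>Pent(u,v)\<close> are empty by parity. Here
  \<open>\<square>(u0) = {v1, v2}\<close> and \<open>\<square>(v0) = U \<union> {u1}\<close>, and their union is connected through \<open>u1\<close> and \<open>v2\<close>.
  So both vertices use up their whole mass, \<open>m\<^sub>a + m\<^sub>a\<square>\<^sub>a = 1\<close>, and the single component contributes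
  at most \<open>1\<close>: the bracket in \<open>W_BM\<close> is not positive.\<close>

lemma bipartition_edge_iff:
  assumes "bipartition V E V1 V2" "(a, b) \<in> E"
  shows "a \<in> V1 \<longleftrightarrow> b \<notin> V1"
  using assms unfolding bipartition_def by blast

text \<open>Every edge switches sides, so the sides of the ends of a walk record the parity of its
  length.\<close>

lemma bipartition_relpow_iff:
  assumes "bipartition V E V1 V2" "(a, b) \<in> E ^^ n"
  shows "(a \<in> V1 \<longleftrightarrow> b \<in> V1) \<longleftrightarrow> even n"
  using assms(2)
proof (induction n arbitrary: b)
  case (Suc n)
  then obtain c where "(a, c) \<in> E ^^ n" "(c, b) \<in> E" by auto
  then show ?case using Suc.IH bipartition_edge_iff[OF assms(1)] by auto
qed simp

text \<open>Reading a cycle as a closed walk lets the parity of walks rule out odd cycles.\<close>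

lemma is_cycle_relpow:
  assumes "is_cycle E n p"
  shows "(p ! 0, p ! 0) \<in> E ^^ n"
proof -
  have "(p ! 0, p ! i) \<in> E ^^ i" if "i < n" for i
    using that
  proof (induction i)
    case (Suc i)
    have "(p ! i, p ! Suc i) \<in> E"
      using assms Suc.prems unfolding is_cycle_def by (metis Suc_lessD mod_less)
    then show ?case using Suc by auto
  qed simp
  moreover obtain m where n: "n = Suc m"
    using assms unfolding is_cycle_def by (cases n) auto
  \<comment> \<open>At the last index \<open>m\<close> the successor wraps around to
    \<open>0\<close>, which closes the walk.\<close>
  moreover have "(p ! m, p ! 0) \<in> E"
    using assms n unfolding is_cycle_def by (metis lessI mod_self)
  ultimately show ?thesis by auto
qed

lemma bipartition_not_on_odd_cycle:
  assumes "bipartition V E V1 V2" "odd n"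
  shows "\<not> on_cycle E n u v w"
  using bipartition_relpow_iff[OF assms(1) is_cycle_relpow] assms(2)
  unfolding on_cycle_def by blast

lemma on_4_cycleI:
  assumes "(u, v) \<in> E" "(v, z) \<in> E" "(z, w) \<in> E" "(w, u) \<in> E" "distinct [u, v, z, w]"
  shows "on_cycle E 4 u v w"
proof -
  let ?p = "[u, v, z, w]"
  have "(?p ! i, ?p ! (Suc i mod 4)) \<in> E" if "i < 4" for i
  proof -
    have "i = 0 \<or> i = 1 \<or> i = 2 \<or> i = 3" using that by linarith
    then show ?thesis using assms by (elim disjE) simp_all
  qed
  then have "is_cycle E 4 ?p" using assms(5) by (simp add: is_cycle_def)
  moreover have "{?p ! 0, ?p ! (Suc 0 mod 4)} = {u, v}" by simp
  moreover have "w \<in> set ?p" by simp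
  ultimately show ?thesis unfolding on_cycle_def by (metis zero_less_numeral)
qed

text \<open>Since \<open>enat\<close> is well-ordered, the infimum over a nonempty set of walk
  lengths is attained. A finite distance excludes the empty set, whose infimum is infinite.\<close>

lemma gdist_eq_enatD:
  assumes "gdist E a b = enat n"
  shows "(a, b) \<in> E ^^ n"
proof -
  let ?A = "enat ` {n. (a, b) \<in> E ^^ n}"
  have "?A \<noteq> {}"
    using assms by (auto simp: gdist_def Inf_enat_def split: if_splits)
  then have "Inf ?A \<in> ?A" by (meson ex_in_conv wellorder_InfI)
  then show ?thesis using assms by (auto simp: gdist_def)
qed

lemma bipartition_triangles_empty:
  assumes "bipartition V E V1 V2" "(u, v) \<in> E"
  shows "triangles E u v = {}"
  using bipartition_edge_iff[OF assms(1)] assms(2) unfolding triangles_def nbrs_def by blast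

lemma bipartition_pents_empty:
  assumes "bipartition V E V1 V2"
  shows "pents E u v = {}"
  using bipartition_not_on_odd_cycle[OF assms, of 5] by (auto simp: pents_def)

text \<open>A vertex at even distance from both ends of an edge would share a side with each of
  them, but the ends lie on opposite sides.\<close>

lemma bipartition_pents_opp_empty:
  assumes "bipartition V E V1 V2" "(u, v) \<in> E"
  shows "pents_opp E u v = {}"
proof -
  have False if "gdist E u w = enat 2" "gdist E v w = enat 2" for w
    using bipartition_relpow_iff[OF assms(1) gdist_eq_enatD, OF that(1)]
      bipartition_relpow_iff[OF assms(1) gdist_eq_enatD, OF that(2)]
      bipartition_edge_iff[OF assms] by auto
  then show ?thesis by (auto simp: pents_opp_def numeral_eq_enat)
qed

lemma bipartition_core_nbhd:
  assumes "bipartition V E V1 V2" "(u, v) \<in> E"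
  shows "core_nbhd E u v = squares E u v \<union> squares E v u"
  using bipartition_triangles_empty[OF assms] bipartition_pents_empty[OF assms(1)]
    bipartition_pents_opp_empty[OF assms] by (simp add: core_nbhd_def)

text \<open>The vertex \<open>z\<close> closes the 4-cycle \<open>u\<close>, \<open>v\<close>,
  \<open>z\<close>, \<open>w\<close>; the condition on 3-cycles is automatic by parity.\<close>

lemma bipartition_squares_eq_nbrs:
  assumes bip: "bipartition V E V1 V2" and "sym E" and uv: "(u, v) \<in> E"
    and z: "\<And>w. w \<in> nbrs E u - {v} \<Longrightarrow> \<exists>z \<in> nbrs E v - {u}. (z, w) \<in> E"
  shows "squares E u v = nbrs E u - {v}"
proof -
  have "on_cycle E 4 u v w" if w: "w \<in> nbrs E u - {v}" for w
  proof -
    obtain z where z: "z \<in> nbrs E v - {u}" "(z, w) \<in> E" using z[OF w] by blast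
    have "(w, u) \<in> E" using w \<open>sym E\<close> by (auto simp: nbrs_def dest: symD)
    \<comment> \<open>Consecutive vertices are adjacent, hence on different sides; the opposite
      pairs \<open>u\<close>, \<open>z\<close> and \<open>v\<close>, \<open>w\<close> differ by the
      choice of \<open>z\<close> and \<open>w\<close>.\<close>
    moreover have "distinct [u, v, z, w]"
      using z w uv bipartition_edge_iff[OF bip] by (auto simp: nbrs_def)
    ultimately show ?thesis using z uv by (intro on_4_cycleI) (auto simp: nbrs_def)
  qed
  then show ?thesis
    using bipartition_not_on_odd_cycle[OF bip, of 3] by (auto simp: squares_def)
qed

text \<open>By symmetry any two vertices of \<open>R\<close> are joined through \<open>c\<close>, so
  the quotient has a single class.\<close>

lemma components_on_connected:
  assumes "sym E" "c \<in> R" "\<And>w. w \<in> R \<Longrightarrow> (c, w) \<in> (E \<inter> R \<times> R)\<^sup>*"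
  shows "components_on E R = {R}"
proof -
  have "sym ((E \<inter> R \<times> R)\<^sup>*)"
    using assms(1) by (intro sym_rtrancl) (blast intro: symI dest: symD)
  then have "(a, b) \<in> (E \<inter> R \<times> R)\<^sup>*" if "a \<in> R" "b \<in> R" for a b
    using assms(3) that by (meson rtrancl_trans symD)
  then show ?thesis using assms(2) by (auto simp: components_on_def quotient_def)
qed

text \<open>The triangle inequality along a shortest walk sums the edge bounds; an infinite distance
  imposes no constraint.\<close>

lemma graph_lipschitz_if_edges:
  assumes "\<And>a b. (a, b) \<in> E \<Longrightarrow> \<bar>x a - x b\<bar> \<le> 1"
  shows "graph_lipschitz V E x"
proof -
  have path: "\<bar>x a - x b\<bar> \<le> real n" if "(a, b) \<in> E ^^ n" for a b n
    using that
  proof (induction n arbitrary: b)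
    case (Suc n)
    then obtain c where "(a, c) \<in> E ^^ n" "(c, b) \<in> E" by auto
    then show ?case using Suc.IH[of c] assms[of c b] by auto
  qed simp
  show ?thesis unfolding graph_lipschitz_def
  proof (intro ballI)
    fix a b
    show "ereal \<bar>x a - x b\<bar> \<le> ereal_of_enat (gdist E a b)"
    proof (cases "gdist E a b")
      case (enat n)
      then show ?thesis using path[OF gdist_eq_enatD] by simp
    qed simp
  qed
qed

theorem mainTheorem1:
  fixes V U :: "'a set" and E :: "'a rel" and u0 u1 v0 v1 v2 :: 'a and x :: "'a \<Rightarrow> real"
  assumes "finite U" and "U \<noteq> {}"
    and "distinct [u0, u1, v0, v1, v2]" and "{u0, u1, v0, v1, v2} \<inter> U = {}"
    and "lf_simple_graph V E"
    and "V = {u0, u1} \<union> U \<union> {v0, v1, v2}"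
    and "bipartition V E ({u0, u1} \<union> U) {v0, v1, v2}"
    and "nbrs E u0 = {v0, v1, v2}" and "nbrs E u1 = {v0, v1, v2}"
    and "\<And>w. w \<in> U \<Longrightarrow> nbrs E w = {v0, v2}"
    and "x v1 = 1"
    and "\<And>a. a \<in> {u0, u1} \<Longrightarrow> x a = 0"
    and "\<And>a. a \<in> {v0, v2} \<Longrightarrow> x a = -1"
    and "\<And>a. a \<in> U \<Longrightarrow> x a = -2"
  shows "W_BM E u0 v0 = 1
    \<and> graph_lipschitz V E x
    \<and> transport_profit E x u0 v0 = (5 * real (card U) - 2) / (3 * real (card U) + 6)
    \<and> (card U > 4 \<longrightarrow> transport_profit E x u0 v0 > W_BM E u0 v0)"
proof -
  let ?n = "real (card U)"
  note bip = assms(7)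
  have symE: "sym E" using assms(5) by (simp add: lf_simple_graph_def)
  have sym_iff: "(a, b) \<in> E \<longleftrightarrow> (b, a) \<in> E" for a b using symE by (auto dest: symD)
  have Eu: "(u0, b) \<in> E \<longleftrightarrow> b \<in> {v0, v1, v2}" "(u1, b) \<in> E \<longleftrightarrow> b \<in> {v0, v1, v2}" for b
    using assms(8,9) by (auto simp: nbrs_def)
  have EU: "(w, b) \<in> E \<longleftrightarrow> b \<in> {v0, v2}" if "w \<in> U" for w b
    using assms(10)[OF that] by (auto simp: nbrs_def)
  have Ev: "(a, v0) \<in> E \<longleftrightarrow> a \<in> {u0, u1} \<union> U" for a
  proof
    assume "(a, v0) \<in> E"
    then show "a \<in> {u0, u1} \<union> U" using bipartition_edge_iff[OF bip] assms(3,4) by auto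
  qed (use Eu EU in auto)
  have Nv: "nbrs E v0 = {u0, u1} \<union> U"
    using Ev sym_iff unfolding nbrs_def by blast
  have e: "(u0, v0) \<in> E" "(v0, u0) \<in> E" using Eu(1)[of v0] sym_iff[of u0 v0] by simp_all
  have Squ: "squares E u0 v0 = {v1, v2}"
  proof -
    have "\<exists>z\<in>nbrs E v0 - {u0}. (z, w) \<in> E" if "w \<in> nbrs E u0 - {v0}" for w
      \<comment> \<open>The twin \<open>u1\<close> of \<open>u0\<close> has the same neighbours, so
        it closes a 4-cycle through any of them.\<close>
      using that Nv assms(3,8) Eu(2)[of w] by (intro bexI[of _ u1]) auto
    then have "squares E u0 v0 = nbrs E u0 - {v0}"
      by (rule bipartition_squares_eq_nbrs[OF bip symE e(1)])
    then show ?thesis using assms(3,8) by auto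
  qed
  have Sqv: "squares E v0 u0 = insert u1 U"
  proof -
    have "\<exists>z\<in>nbrs E u0 - {v0}. (z, w) \<in> E" if "w \<in> nbrs E v0 - {u0}" for w
      \<comment> \<open>Here \<open>v2\<close> serves for every \<open>w\<close>, being adjacent to
        \<open>u1\<close> and to all of \<open>U\<close>.\<close>
      using that Nv assms(3,8) Eu(2)[of v2] EU[of w v2] sym_iff[of v2 w]
      by (intro bexI[of _ v2]) auto
    then have "squares E v0 u0 = nbrs E v0 - {u0}"
      by (rule bipartition_squares_eq_nbrs[OF bip symE e(2)])
    then show ?thesis using assms(3,4) Nv by auto
  qed
  define R where "R = core_nbhd E u0 v0"
  have R: "R = {v1, v2} \<union> insert u1 U"
    using bipartition_core_nbhd[OF bip e(1)] Squ Sqv by (simp add: R_def)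
  have comp: "components_on E R = {R}"
  proof (rule components_on_connected[OF symE])
    show "v2 \<in> R" by (simp add: R)
    fix w assume w: "w \<in> R"
    let ?S = "E \<inter> R \<times> R"
    have nb: "(v2, w) \<in> ?S" if "w \<in> insert u1 U" for w
      using that Eu EU sym_iff[of v2 w] by (auto simp: R)
    \<comment> \<open>Within \<open>R\<close> the only neighbour of \<open>v1\<close> is
      \<open>u1\<close>, so \<open>v1\<close> is reached from \<open>v2\<close> in two
      steps.\<close>
    have "(u1, v1) \<in> ?S" using Eu by (auto simp: R)
    then have "(v2, v1) \<in> ?S\<^sup>*" 
      using nb[of u1] by (meson insertI1 r_into_rtrancl rtrancl.rtrancl_into_rtrancl)
    then show "(v2, w) \<in> ?S\<^sup>*" using nb w unfolding R by blast
  qed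
  have mass_u: "mass E u0 = 1 / 3"
    using assms(3,8) by (simp add: mass_def deg_def)
  have mass_v: "mass E v0 = 1 / (?n + 2)"
    using assms(1,3,4) Nv by (simp add: mass_def deg_def)
  have card_u: "real (card (squares E u0 v0)) = 2"
    using Squ assms(3) by simp
  have card_v: "real (card (squares E v0 u0)) = ?n + 1"
    using Sqv assms(1,4) by simp
  have Int: "R \<inter> squares E u0 v0 = squares E u0 v0" "R \<inter> squares E v0 u0 = squares E v0 u0"
    using Squ Sqv R by auto
  have bm: "W_BM E u0 v0 = 1"
  proof -
    have "1 / (?n + 2) + 1 / (?n + 2) * (?n + 1) = 1" "1 / (?n + 2) * (?n + 1) \<le> 1"
      by (simp_all add: field_simps)
    then have "1 - 1/3 - 1 / (?n + 2) - 1/3 * 2 - 1 / (?n + 2) * (?n + 1)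
        + max (1/3 * 2) (1 / (?n + 2) * (?n + 1)) \<le> (0::real)" by linarith
    then show ?thesis
      unfolding W_BM_def R_def[symmetric] comp by (simp add: Int card_u card_v mass_u mass_v)
  qed
  \<comment> \<open>With \<open>a\<close> on the side of \<open>u0\<close>, only two kinds of edges
    remain: from value \<open>0\<close> to \<open>1\<close> or \<open>-1\<close>, and from
    \<open>-2\<close> to \<open>-1\<close>.\<close>
  have edge: "\<bar>x a - x b\<bar> \<le> 1" if "(a, b) \<in> E" "a \<in> {u0, u1} \<union> U" for a b
    using that Eu EU assms(11-14) by auto
  have lip: "graph_lipschitz V E x"
  proof (rule graph_lipschitz_if_edges)
    fix a b assume "(a, b) \<in> E"
    then show "\<bar>x a - x b\<bar> \<le> 1"
      using edge[of a b] edge[of b a] sym_iff[of a b] bipartition_edge_iff[OF bip]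
      by (metis abs_minus_commute)
  qed
  have tp: "transport_profit E x u0 v0 = (5 * ?n - 2) / (3 * ?n + 6)"
  proof -
    have "(\<Sum>a\<in>nbrs E u0. x a) = -1"
      using assms(3,8,11,13) by simp
    \<comment> \<open>The vertices \<open>u0\<close> and \<open>u1\<close> contribute
      \<open>0\<close>, so the profit becomes \<open>- 1/3 + 2 * ?n / (?n + 2)\<close>.\<close>
    moreover have "(\<Sum>b\<in>nbrs E v0. x b) = - 2 * ?n"
      using Nv assms(1,3,4,12,14) by simp
    ultimately show ?thesis
      by (simp add: transport_profit_def mass_u mass_v field_simps)
  qed
  \<comment> \<open>The threshold comes from \<open>5 * ?n - 2 > 3 * ?n + 6\<close>, that is,
    \<open>?n > 4\<close>.\<close>
  have "transport_profit E x u0 v0 > 1" if "card U > 4"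
    using that by (simp add: tp field_simps)
  then show ?thesis using bm lip tp by simp
qed

end
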